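(* Let $(G_n)$ be a family of expander graphs, where $G_n$ is a connected graph on $n$ vertices and the maximum degrees of all $G_n$ are bounded by a constant $\Delta$ independent of $n$. Then, as $n\to\infty$, the maximum load $X_{\max}^{(n)}$ after $n$ balls are allocated to the vertices of $G_n$ by the local search allocation (with ties broken uniformly at random) is $\Theta(\log\log n)$ with probability $1-o(1)$; that is, there are constants $0<c\le C<\infty$ independent of $n$ such that $\Pr[\,c\log\log n\le X_{\max}^{(n)}\le C\log\log n\,]\to 1$ as $n\to\infty$.
   Context: Local search allocation on a finite, undirected, connected graph $G=(V,E)$ with $|V|=n$: the vertices are bins, all initially with load $0$. Balls $1,2,\dots$ are allocated one after another. Ball $i$ is born at a vertex $U_i$ (its birthplace), where $U_1,U_2,\dots$ are independent and uniform on $V$. Starting at $U_i$, as long as the current vertex has a neighbor whose load is strictly smaller than the load of the current vertex, the ball moves to a neighbor of smallest load; ties among the neighbors of smallest load are broken uniformly at random, independently. The search stops at the first vertex none of whose neighbors has a smaller load (a local minimum); the ball is placed there and the load of that vertex increases by $1$. $X_v^{(i)}$ is the load of $v$ right after ball $i$ is placed, and $X_{\max}^{(n)}=\max_{v\in V}X_v^{(n)}$. Family of expander graphs (standard notion): there is a constant $\alpha>0$, independent of $n$, such that for every $G_n=(V,E)$ in the family and every $S\subseteq V$ with $1\le |S|\le |V|/2$, the number of vertices outside $S$ adjacent to some vertex of $S$ is at least $\alpha|S|$. *)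

theory Defs
  imports "HOL-Probability.Probability" "Graph_Theory.Digraph_Component"
begin

text \<open>
  Finite, undirected, simple graphs are the symmetric digraphs of the locale \<^locale>\<open>graph\<close>:
  every edge is represented by its two orientations, so that \<^const>\<open>out_degree\<close> is the usual
  degree of a vertex.
\<close>

definition neighbours :: "('v, 'e) pre_digraph \<Rightarrow> 'v \<Rightarrow> 'v set" where
  "neighbours G v = {w. v \<rightarrow>\<^bsub>G\<^esub> w}"

definition vertex_boundary :: "('v, 'e) pre_digraph \<Rightarrow> 'v set \<Rightarrow> 'v set" where
  "vertex_boundary G S = {w \<in> verts G - S. \<exists>v\<in>S. w \<in> neighbours G v}"

definition vertex_expander :: "real \<Rightarrow> ('v, 'e) pre_digraph \<Rightarrow> bool" where
  "vertex_expander \<alpha> G \<longleftrightarrow>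
     (\<forall>S \<subseteq> verts G. 1 \<le> card S \<and> real (card S) \<le> real (card (verts G)) / 2 \<longrightarrow>
        real (card (vertex_boundary G S)) \<ge> \<alpha> * real (card S))"

definition expander_family :: "('v, 'e) pre_digraph set \<Rightarrow> bool" where
  "expander_family \<G> \<longleftrightarrow> (\<exists>\<alpha>>0. \<forall>G\<in>\<G>. vertex_expander \<alpha> G)"

definition min_neighbours :: "('v, 'e) pre_digraph \<Rightarrow> ('v \<Rightarrow> nat) \<Rightarrow> 'v \<Rightarrow> 'v set" where
  "min_neighbours G x v = {w \<in> neighbours G v. \<forall>u \<in> neighbours G v. x w \<le> x u}"

text \<open>
  The law of the vertex at which a ball started at \<open>v\<close> stops when the current loads are \<open>x\<close>.
  The finiteness guard always holds in a finite graph; it is only there because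
  \<^const>\<open>pmf_of_set\<close> is unspecified on infinite sets, which would obstruct termination.
\<close>

function local_search :: "('v, 'e) pre_digraph \<Rightarrow> ('v \<Rightarrow> nat) \<Rightarrow> 'v \<Rightarrow> 'v pmf" where
  "local_search G x v =
     (if finite (neighbours G v) \<and> (\<exists>w \<in> neighbours G v. x w < x v)
      then bind_pmf (pmf_of_set (min_neighbours G x v)) (\<lambda>w. local_search G x w)
      else return_pmf v)"
  by pat_completeness auto
termination
proof (relation "Wellfounded.measure (\<lambda>(G, x, v). x v)", goal_cases)
  case 1
  then show ?case by simp
next
  case (2 G x v w)
  then obtain u where u: "u \<in> neighbours G v" "x u < x v"
    by blast
  have fin: "finite (min_neighbours G x v)"
    using 2 by (simp add: min_neighbours_def)
  obtain m where "m \<in> neighbours G v" "\<forall>y. y \<in> neighbours G v \<longrightarrow> x m \<le> x y"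
    using ex_has_least_nat[of "\<lambda>y. y \<in> neighbours G v" u x] u by blast
  then have "min_neighbours G x v \<noteq> {}"
    by (auto simp: min_neighbours_def)
  then have "w \<in> min_neighbours G x v"
    using 2 fin by simp
  then have "x w \<le> x u"
    using u by (simp add: min_neighbours_def)
  then show ?case using u by simp
qed

declare local_search.simps [simp del]

text \<open>
  The law of the load vector after \<open>i\<close> balls. Birthplaces and tie-breaking choices are drawn
  afresh for every ball, which encodes their independence.
\<close>

primrec loads :: "('v, 'e) pre_digraph \<Rightarrow> nat \<Rightarrow> ('v \<Rightarrow> nat) pmf" where
  "loads G 0 = return_pmf (\<lambda>_. 0)"
| "loads G (Suc i) =
     bind_pmf (loads G i) (\<lambda>x.
       bind_pmf (pmf_of_set (verts G)) (\<lambda>u.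
         map_pmf (\<lambda>v. x(v := x v + 1)) (local_search G x u)))"

definition max_load :: "('v, 'e) pre_digraph \<Rightarrow> ('v \<Rightarrow> nat) \<Rightarrow> nat" where
  "max_load G x = Max (x ` verts G)"

end

theory Submission
  imports Defs "HOL-Real_Asymp.Real_Asymp"
begin

text \<open>
  Upper bound. Throughout the process the loads of adjacent vertices differ by at most one. Cut the
  \<open>n\<close> balls into a constant number of rounds of at most \<open>\<epsilon> n\<close> balls each. If all loads are at
  most \<open>k\<close> at the start of a round, then every component \<open>C\<close> of the vertices of load above \<open>k\<close> at
  its end has received all the balls above height \<open>k\<close> from births inside \<open>C\<close>, so at least \<open>|C|\<close>
  balls of the round were born in \<open>C\<close>. A given set of size \<open>s\<close> has that many births with
  probability at most \<open>(e \<epsilon>) ^ s\<close>, and there are at most \<open>n (\<Delta> + 1) ^ (2 s)\<close> connected sets of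
  size \<open>s\<close>; for small \<open>\<epsilon>\<close> all components thus have fewer than \<open>ln n\<close> vertices. By expansion the
  superlevel sets within a component shrink geometrically, hence a round raises the maximum load by
  \<open>O(ln (ln n))\<close> only.

  Lower bound. With high probability some vertex is the birthplace of at least \<open>sqrt (ln n)\<close> balls.
  If all loads are at most \<open>r\<close>, all of these stay within distance \<open>r\<close>, where there is room for at
  most \<open>r (\<Delta> + 1) ^ r\<close> balls.
\<close>

section \<open>Local search and the joint process of loads and births\<close>

context graph
begin

lemma neighbours_sym: "w \<in> neighbours G v \<longleftrightarrow> v \<in> neighbours G w"
  using graph_symmetric by (auto simp: neighbours_def)

lemma neighbours_subset_verts: "neighbours G v \<subseteq> verts G"
  by (auto simp: neighbours_def dest: adj_in_verts)

lemma finite_neighbours: "finite (neighbours G v)"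
  using finite_subset[OF neighbours_subset_verts finite_verts] .

lemma card_neighbours_le: "card (neighbours G v) \<le> out_degree G v"
proof -
  have "neighbours G v \<subseteq> head G ` out_arcs G v"
    by (auto simp: neighbours_def arcs_ends_conv)
  then show ?thesis
    unfolding out_degree_def
    by (meson card_image_le card_mono finite_imageI finite_out_arcs order_trans)
qed

text \<open>Every move strictly lowers the load of the current vertex, so a search path admits
  well-founded induction on that load. Facts about paths can then ignore the law of the
  tie-breaking.\<close>

lemma local_search_induct [consumes 1, case_names stop step]:
  assumes "v \<in> set_pmf (local_search G x u)"
    and "\<And>u. \<forall>w \<in> neighbours G u. x u \<le> x w \<Longrightarrow> v = u \<Longrightarrow> P u"
    and "\<And>u w. w \<in> neighbours G u \<Longrightarrow> x w < x u \<Longrightarrow> v \<in> set_pmf (local_search G x w) \<Longrightarrow>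
           P w \<Longrightarrow> P u"
  shows "P u"
  using assms(1)
proof (induction "x u" arbitrary: u rule: less_induct)
  case less
  show ?case
  proof (cases "\<exists>w \<in> neighbours G u. x w < x u")
    case True
    then obtain m where m: "m \<in> neighbours G u" "\<And>y. y \<in> neighbours G u \<Longrightarrow> x m \<le> x y"
      using ex_has_least_nat[of "\<lambda>y. y \<in> neighbours G u" _ x] by blast
    have "min_neighbours G x u \<noteq> {}" "finite (min_neighbours G x u)"
      using m finite_neighbours by (auto simp: min_neighbours_def)
    moreover have "local_search G x u =
        bind_pmf (pmf_of_set (min_neighbours G x u)) (local_search G x)"
      using True finite_neighbours by (subst local_search.simps) auto
    ultimately obtain w where w: "w \<in> min_neighbours G x u" "v \<in> set_pmf (local_search G x w)"
      using less.prems by auto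
    moreover have "x w < x u"
      using True w(1) by (force simp: min_neighbours_def)
    ultimately show ?thesis
      using less.hyps assms(3) by (auto simp: min_neighbours_def)
  next
    case False
    then have "v = u"
      using less.prems by (subst (asm) local_search.simps) auto
    then show ?thesis
      using False assms(2) by (auto simp: not_less)
  qed
qed

lemma local_search_local_min:
  assumes "v \<in> set_pmf (local_search G x u)" "w \<in> neighbours G v"
  shows "x v \<le> x w"
  using assms by (induction rule: local_search_induct) auto

lemma local_search_in_verts:
  assumes "v \<in> set_pmf (local_search G x u)" "u \<in> verts G"
  shows "v \<in> verts G"
  using assms by (induction rule: local_search_induct) (use neighbours_subset_verts in auto)

lemma local_search_descends:
  assumes "v \<in> set_pmf (local_search G x u)"
  shows "x v \<le> x u"
  using assms by (induction rule: local_search_induct) auto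

lemma finite_set_pmf_local_search:
  assumes "u \<in> verts G"
  shows "finite (set_pmf (local_search G x u))"
  using finite_subset[OF _ finite_verts] local_search_in_verts[OF _ assms] by blast

end

section \<open>Smooth loads and the coupling of loads with birth counts\<close>

definition smooth :: "('v, 'e) pre_digraph \<Rightarrow> ('v \<Rightarrow> nat) \<Rightarrow> bool" where
  "smooth G x \<longleftrightarrow> (\<forall>u. \<forall>w \<in> neighbours G u. x u \<le> x w + 1)"

text \<open>
  The second component counts the balls born at each vertex; the loads start from \<open>x\<close> but the
  counts from zero, so that the process can be restarted after every round.
\<close>

primrec loads_births ::
  "('v, 'e) pre_digraph \<Rightarrow> ('v \<Rightarrow> nat) \<Rightarrow> nat \<Rightarrow> (('v \<Rightarrow> nat) \<times> ('v \<Rightarrow> nat)) pmf" where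
  "loads_births G x 0 = return_pmf (x, \<lambda>_. 0)"
| "loads_births G x (Suc i) =
     bind_pmf (loads_births G x i) (\<lambda>(y, b).
       bind_pmf (pmf_of_set (verts G)) (\<lambda>u.
         map_pmf (\<lambda>v. (y(v := y v + 1), b(u := b u + 1))) (local_search G y u)))"

primrec births :: "'v set \<Rightarrow> nat \<Rightarrow> ('v \<Rightarrow> nat) pmf" where
  "births V 0 = return_pmf (\<lambda>_. 0)"
| "births V (Suc i) =
     bind_pmf (births V i) (\<lambda>b. map_pmf (\<lambda>u. b(u := b u + 1)) (pmf_of_set V))"

text \<open>Birthplaces are drawn without regard to the loads, so the search integrates out.
  Probability bounds proved for \<open>births\<close> thereby transfer to the joint process from any
  initial loads.\<close>

lemma births_loads_births: "map_pmf snd (loads_births G x i) = births (verts G) i"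
proof (induction i)
  case (Suc i)
  have "map_pmf snd (loads_births G x (Suc i)) =
      bind_pmf (loads_births G x i) (\<lambda>p.
        map_pmf (\<lambda>u. (snd p)(u := snd p u + 1)) (pmf_of_set (verts G)))"
    by (simp add: map_bind_pmf case_prod_beta' map_pmf_comp map_pmf_const flip: map_pmf_def)
  also have "\<dots> = bind_pmf (map_pmf snd (loads_births G x i)) (\<lambda>b.
        map_pmf (\<lambda>u. b(u := b u + 1)) (pmf_of_set (verts G)))"
    by (simp add: bind_map_pmf)
  finally show ?case
    using Suc by simp
qed simp

text \<open>The Markov property at time \<open>i\<close>, which allows the process to be restarted
  between rounds.\<close>

lemma loads_add:
  "loads G (i + j) = bind_pmf (loads G i) (\<lambda>x. map_pmf fst (loads_births G x j))"
proof (induction j)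
  case 0
  then show ?case by (simp add: bind_return_pmf')
next
  case (Suc j)
  then show ?case
    by (simp add: bind_assoc_pmf bind_map_pmf map_bind_pmf case_prod_beta' map_pmf_comp)
qed

context graph
begin

lemma loads_births_SucE:
  assumes "(y, b) \<in> set_pmf (loads_births G x (Suc i))" "verts G \<noteq> {}"
  obtains y' b' u v where "(y', b') \<in> set_pmf (loads_births G x i)" "u \<in> verts G"
    "v \<in> set_pmf (local_search G y' u)" "y = y'(v := y' v + 1)" "b = b'(u := b' u + 1)"
proof -
  from assms obtain p u where "p \<in> set_pmf (loads_births G x i)" "u \<in> verts G"
    "(y, b) \<in> set_pmf (map_pmf (\<lambda>v. ((fst p)(v := fst p v + 1), (snd p)(u := snd p u + 1)))
      (local_search G (fst p) u))"
    by (simp only: loads_births.simps set_bind_pmf case_prod_beta' UN_iff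
          set_pmf_of_set[OF assms(2) finite_verts]) blast
  then show ?thesis
    using that[of "fst p" "snd p" u] by auto
qed

lemma finite_set_pmf_loads_births:
  assumes "verts G \<noteq> {}"
  shows "finite (set_pmf (loads_births G x i))"
  using assms
  by (induction i)
     (auto simp: finite_set_pmf_local_search set_pmf_of_set[OF assms finite_verts])

text \<open>The load grows only at a local minimum, which ends up at most one above its neighbours.
  As adjacency is symmetric, the one-sided inequality in \<open>smooth\<close> bounds the difference
  in both directions.\<close>

lemma smooth_place:
  assumes "smooth G x" "v \<in> set_pmf (local_search G x u)"
  shows "smooth G (x(v := x v + 1))"
  unfolding smooth_def
proof (intro allI ballI)
  fix a w assume w: "w \<in> neighbours G a"
  then have "x a \<le> x w + 1"
    using assms(1) by (auto simp: smooth_def)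
  moreover have "x v \<le> x w" if "a = v"
    using that w local_search_local_min[OF assms(2)] by auto
  ultimately show "(x(v := x v + 1)) a \<le> (x(v := x v + 1)) w + 1"
    by auto
qed

lemma smooth_loads_births:
  assumes "(y, b) \<in> set_pmf (loads_births G x i)" "smooth G x" "verts G \<noteq> {}"
  shows "smooth G y"
  using assms(1)
proof (induction i arbitrary: y b)
  case (Suc i)
  from Suc.prems assms(3) obtain y' b' u v where
    "(y', b') \<in> set_pmf (loads_births G x i)" "v \<in> set_pmf (local_search G y' u)"
    "y = y'(v := y' v + 1)"
    by (rule loads_births_SucE)
  then show ?case
    using Suc.IH smooth_place by blast
qed (use assms in auto)

lemma smooth_loads:
  assumes "x \<in> set_pmf (loads G i)" "verts G \<noteq> {}"
  shows "smooth G x"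
proof -
  have "\<exists>b. (x, b) \<in> set_pmf (loads_births G (\<lambda>_. 0) i)"
    using assms(1) loads_add[of G 0 i] by (auto simp: bind_return_pmf)
  moreover have "smooth G (\<lambda>_. 0)"
    by (simp add: smooth_def)
  ultimately show ?thesis
    using smooth_loads_births assms(2) by blast
qed

text \<open>
  Along a search the loads decrease strictly, so a ball that ends at height above \<open>k\<close> in \<open>C\<close> has
  only visited vertices of load above \<open>k\<close>; by closedness it never entered \<open>C\<close> from outside.
\<close>

lemma local_search_starts_in_component:
  assumes "v \<in> set_pmf (local_search G x u)" "v \<in> C" "k \<le> x v"
    and "\<And>a w. a \<in> C \<Longrightarrow> w \<in> neighbours G a \<Longrightarrow> k < x w \<Longrightarrow> w \<in> C"
  shows "u \<in> C"
  using assms(1)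
proof (induction rule: local_search_induct)
  case (stop u)
  then show ?case using assms by simp
next
  case (step u w)
  then show ?case
    using local_search_descends[OF step(3)] assms(3,4) neighbours_sym by fastforce
qed

text \<open>A ball raises the left side only if it lands in \<open>C\<close> on a load of at least
  \<open>k\<close>. By \<open>local_search_starts_in_component\<close> it was then born in
  \<open>C\<close>, so the right side rises as well.\<close>

lemma excess_le_births:
  assumes "(y, b) \<in> set_pmf (loads_births G x i)" "verts G \<noteq> {}"
    and "\<And>v. v \<in> verts G \<Longrightarrow> x v \<le> k"
    and "finite C" "C \<subseteq> verts G"
    and "\<And>a w. a \<in> C \<Longrightarrow> w \<in> neighbours G a \<Longrightarrow> k < y w \<Longrightarrow> w \<in> C"
  shows "(\<Sum>v\<in>C. y v - k) \<le> (\<Sum>v\<in>C. b v)"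
  using assms(1,6)
proof (induction i arbitrary: y b)
  case 0
  then show ?case
    using assms(3,5) by (force intro!: sum.neutral)
next
  case (Suc i)
  from Suc.prems(1) assms(2) obtain y' b' u v where
    IH: "(y', b') \<in> set_pmf (loads_births G x i)" and u: "u \<in> verts G"
    and v: "v \<in> set_pmf (local_search G y' u)"
    and eq: "y = y'(v := y' v + 1)" "b = b'(u := b' u + 1)"
    by (rule loads_births_SucE)
  \<comment> \<open>Loads only grow, so closedness with respect to the final loads is inherited by
    all earlier ones.\<close>
  have closed: "w \<in> C" if "a \<in> C" "w \<in> neighbours G a" "k < y' w" for a w
    using Suc.prems(2)[OF that(1,2)] that(3) by (cases "w = v") (auto simp: eq)
  have le: "(\<Sum>v\<in>C. y' v - k) \<le> (\<Sum>v\<in>C. b' v)"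
    using Suc.IH[OF IH] closed by blast
  \<comment> \<open>Subtraction is truncated: balls landing on loads below \<open>k\<close> leave
    the excess at zero.\<close>
  have sum_y: "(\<Sum>a\<in>C. y a - k) = (\<Sum>a\<in>C. y' a - k) + (if v \<in> C \<and> k \<le> y' v then 1 else 0)"
  proof -
    have "(\<Sum>a\<in>C. y a - k) = (\<Sum>a\<in>C. (y' a - k) + (if a = v then if k \<le> y' v then 1 else 0 else 0))"
      by (intro sum.cong) (auto simp: eq)
    then show ?thesis
      using assms(4) by (simp add: sum.distrib)
  qed
  have sum_b: "(\<Sum>a\<in>C. b a) = (\<Sum>a\<in>C. b' a) + (if u \<in> C then 1 else 0)"
  proof -
    have "(\<Sum>a\<in>C. b a) = (\<Sum>a\<in>C. b' a + (if a = u then 1 else 0))"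
      by (intro sum.cong) (auto simp: eq)
    then show ?thesis
      using assms(4) by (simp add: sum.distrib)
  qed
  have "u \<in> C" if "v \<in> C" "k \<le> y' v"
    using local_search_starts_in_component[OF v that closed] .
  then show ?case
    using le sum_y sum_b by auto
qed

section \<open>Balls in the graph distance and the births at one vertex\<close>

primrec nbhd :: "nat \<Rightarrow> 'a \<Rightarrow> 'a set" where
  "nbhd 0 u = {u}"
| "nbhd (Suc r) u = insert u (\<Union>w \<in> neighbours G u. nbhd r w)"

lemma finite_nbhd: "finite (nbhd r u)"
  by (induction r arbitrary: u) (auto simp: finite_neighbours)

lemma nbhd_mono:
  assumes "r \<le> s"
  shows "nbhd r u \<subseteq> nbhd s u"
  using assms
proof (induction r arbitrary: s u)
  case 0
  then show ?case by (cases s) auto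
next
  case (Suc r)
  then obtain s' where "s = Suc s'" "r \<le> s'"
    by (cases s) auto
  then show ?case
    using Suc.IH[of s'] by fastforce
qed

lemma card_nbhd_le:
  assumes "\<And>v. v \<in> verts G \<Longrightarrow> out_degree G v \<le> \<Delta>" "u \<in> verts G"
  shows "card (nbhd r u) \<le> (\<Delta> + 1) ^ r"
  using assms(2)
proof (induction r arbitrary: u)
  case (Suc r)
  have "card (\<Union>w \<in> neighbours G u. nbhd r w) \<le> (\<Sum>w \<in> neighbours G u. card (nbhd r w))"
    by (rule card_UN_le[OF finite_neighbours])
  also have "\<dots> \<le> (\<Sum>w \<in> neighbours G u. (\<Delta> + 1) ^ r)"
    using Suc.IH neighbours_subset_verts by (intro sum_mono) auto
  also have "\<dots> = card (neighbours G u) * (\<Delta> + 1) ^ r"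
    by simp
  also have "\<dots> \<le> \<Delta> * (\<Delta> + 1) ^ r"
    using card_neighbours_le[of u] assms(1)[OF Suc.prems] by (intro mult_right_mono) auto
  finally have "card (nbhd (Suc r) u) \<le> 1 + \<Delta> * (\<Delta> + 1) ^ r"
    using card_insert_le_m1 by (simp add: card_insert_if finite_neighbours finite_nbhd)
  also have "\<dots> \<le> (\<Delta> + 1) ^ Suc r"
    by simp
  finally show ?case .
qed simp

lemma nbhd_subset_verts:
  assumes "u \<in> verts G"
  shows "nbhd r u \<subseteq> verts G"
  using assms by (induction r arbitrary: u) (use neighbours_subset_verts in fastforce)+

text \<open>Each move costs at least one unit of load, so the search makes at most
  \<open>x u\<close> moves.\<close>

lemma local_search_in_nbhd:
  assumes "v \<in> set_pmf (local_search G x u)"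
  shows "v \<in> nbhd (x u) u"
  using assms
proof (induction rule: local_search_induct)
  case (stop u)
  then show ?case by (cases "x u") auto
next
  case (step u w)
  then obtain r where "x u = Suc r" "x w \<le> r"
    by (cases "x u") auto
  then show ?case
    using step nbhd_mono[of "x w" r] by auto
qed

text \<open>Loads are monotone in time, so every ball born at \<open>u\<close> starts on a load of
  at most \<open>r\<close> and is placed within distance \<open>r\<close>, where it contributes one
  to the right side.\<close>

lemma births_le_nbhd_loads:
  assumes "(y, b) \<in> set_pmf (loads_births G x i)" "verts G \<noteq> {}" "u \<in> verts G"
    and "\<And>v. v \<in> verts G \<Longrightarrow> y v \<le> r"
  shows "b u \<le> (\<Sum>v \<in> nbhd r u. y v)"
  using assms(1,4)
proof (induction i arbitrary: y b)
  case (Suc i)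
  from Suc.prems(1) assms(2) obtain y' b' a v where
    IH: "(y', b') \<in> set_pmf (loads_births G x i)" and a: "a \<in> verts G"
    and v: "v \<in> set_pmf (local_search G y' a)"
    and eq: "y = y'(v := y' v + 1)" "b = b'(a := b' a + 1)"
    by (rule loads_births_SucE)
  have y'_le: "y' w \<le> y w" for w
    by (simp add: eq)
  then have r: "y' w \<le> r" if "w \<in> verts G" for w
    using Suc.prems(2)[OF that] order_trans by blast
  have "b' u \<le> (\<Sum>v \<in> nbhd r u. y' v)"
    using Suc.IH[OF IH] r by blast
  moreover have "(\<Sum>w \<in> nbhd r u. y w) =
      (\<Sum>w \<in> nbhd r u. y' w) + (if v \<in> nbhd r u then 1 else 0)"
  proof -
    have "(\<Sum>w \<in> nbhd r u. y w) = (\<Sum>w \<in> nbhd r u. y' w + (if w = v then 1 else 0))"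
      by (intro sum.cong) (auto simp: eq)
    then show ?thesis
      by (simp add: sum.distrib finite_nbhd)
  qed
  moreover have "v \<in> nbhd r u" if "a = u"
    using local_search_in_nbhd[OF v] nbhd_mono[OF r[OF assms(3)]] that by auto
  ultimately show ?case
    by (auto simp: eq)
qed simp

text \<open>Used in the contrapositive: many births at a single vertex force a load above
  \<open>r\<close> somewhere.\<close>

lemma births_le_power:
  assumes "(y, b) \<in> set_pmf (loads_births G x i)" "verts G \<noteq> {}" "u \<in> verts G"
    and "\<And>v. v \<in> verts G \<Longrightarrow> y v \<le> r"
    and "\<And>v. v \<in> verts G \<Longrightarrow> out_degree G v \<le> \<Delta>"
  shows "b u \<le> r * (\<Delta> + 1) ^ r"
proof -
  have "b u \<le> (\<Sum>v \<in> nbhd r u. y v)"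
    using births_le_nbhd_loads assms by blast
  also have "\<dots> \<le> card (nbhd r u) * r"
    using assms(3,4) nbhd_subset_verts by (intro sum_bounded_above[of _ _ r, simplified]) auto
  also have "\<dots> \<le> r * (\<Delta> + 1) ^ r"
    using card_nbhd_le[of \<Delta> u r] assms(3,5) by simp
  finally show ?thesis .
qed

end

section \<open>Birth counts\<close>

text \<open>Makes sets of fewer than \<open>ln n\<close> vertices small enough for the expansion
  condition.\<close>

lemma ln_le_half: "ln (real n) \<le> real n / 2"
proof (cases "n = 0")
  case False
  have "ln (real n) = ln (real n / 2) + ln 2"
    using False by (simp add: ln_div)
  also have "\<dots> \<le> (real n / 2 - 1) + 1"
    using False ln_le_minus_one[of "real n / 2"] ln_le_minus_one[of 2] by (intro add_mono) auto
  finally show ?thesis by simp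
qed simp

lemma expectation_bind_pmf_finite:
  fixes h :: "'b \<Rightarrow> real"
  assumes "finite (set_pmf p)" "\<And>a. a \<in> set_pmf p \<Longrightarrow> finite (set_pmf (f a))"
  shows "measure_pmf.expectation (bind_pmf p f) h =
    measure_pmf.expectation p (\<lambda>a. measure_pmf.expectation (f a) h)"
  using assms
  by (simp add: pmf_expectation_bind[where A = "set_pmf p"]
        integral_measure_pmf[where A = "set_pmf p"])

lemma prob_le_expectation:
  fixes h :: "'b \<Rightarrow> real"
  assumes "finite (set_pmf p)" "\<And>a. 0 \<le> h a" "\<And>a. a \<in> A \<Longrightarrow> 1 \<le> h a"
  shows "measure_pmf.prob p A \<le> measure_pmf.expectation p h"
proof -
  have "measure_pmf.prob p A = measure_pmf.expectation p (indicator A)"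
    by simp
  also have "\<dots> \<le> measure_pmf.expectation p h"
    using assms by (intro integral_mono integrable_measure_pmf_finite) (auto simp: indicator_def)
  finally show ?thesis .
qed

text \<open>A union bound over two stages: either the first outcome is in the bad set
  \<open>B\<close>, or the second stage fails with probability at most
  \<open>\<delta>\<close>.\<close>

lemma prob_bind_pmf_le:
  assumes "finite (set_pmf p)" "\<And>a. a \<in> set_pmf p \<Longrightarrow> finite (set_pmf (f a))"
    and "\<And>a. a \<in> set_pmf p \<Longrightarrow> a \<notin> B \<Longrightarrow> measure_pmf.prob (f a) A \<le> \<delta>" "0 \<le> \<delta>"
  shows "measure_pmf.prob (bind_pmf p f) A \<le> measure_pmf.prob p B + \<delta>"
proof -
  have "measure_pmf.prob (bind_pmf p f) A = measure_pmf.expectation (bind_pmf p f) (indicator A)"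
    by simp
  also have "\<dots> = measure_pmf.expectation p (\<lambda>a. measure_pmf.prob (f a) A)"
    using assms(1,2) by (subst expectation_bind_pmf_finite) auto
  also have "\<dots> \<le> measure_pmf.expectation p (\<lambda>a. indicator B a + \<delta>)"
  proof (intro integral_mono_AE integrable_measure_pmf_finite assms(1))
    show "AE a in measure_pmf p. measure_pmf.prob (f a) A \<le> indicator B a + \<delta>"
      using assms(3,4) measure_pmf.prob_le_1
      by (auto simp: AE_measure_pmf_iff indicator_def intro: order_trans add_increasing2)
  qed
  also have "\<dots> = measure_pmf.prob p B + \<delta>"
    using assms(1) by (simp add: integrable_measure_pmf_finite)
  finally show ?thesis .
qed

lemma finite_set_pmf_births:
  assumes "finite V" "V \<noteq> {}"
  shows "finite (set_pmf (births V m))"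
  using assms by (induction m) (auto simp: set_pmf_of_set)

lemma expectation_births_Suc:
  fixes h :: "('v \<Rightarrow> nat) \<Rightarrow> real"
  assumes "finite V" "V \<noteq> {}"
  shows "measure_pmf.expectation (births V (Suc m)) h =
    measure_pmf.expectation (births V m) (\<lambda>b. (\<Sum>u\<in>V. h (b(u := b u + 1))) / card V)"
  using assms
  by (simp add: expectation_bind_pmf_finite finite_set_pmf_births set_pmf_of_set integral_pmf_of_set)

text \<open>The generating function of a binomial variable: each birth hits \<open>C\<close>
  independently with probability \<open>card C / card V\<close>.\<close>

lemma expectation_births_power:
  fixes z :: real
  assumes "finite V" "V \<noteq> {}" "C \<subseteq> V"
  shows "measure_pmf.expectation (births V m) (\<lambda>b. z ^ (\<Sum>v\<in>C. b v)) =
    (1 + (z - 1) * card C / card V) ^ m"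
proof (induction m)
  case (Suc m)
  have fin: "finite C"
    using assms finite_subset by blast
  have "(\<Sum>u\<in>V. z ^ (\<Sum>v\<in>C. (b(u := b u + 1)) v)) / card V =
      z ^ (\<Sum>v\<in>C. b v) * (1 + (z - 1) * card C / card V)" for b :: "'a \<Rightarrow> nat"
  proof -
    have "(\<Sum>v\<in>C. (b(u := b u + 1)) v) = (\<Sum>v\<in>C. b v) + (if u \<in> C then 1 else 0)" for u
    proof -
      have "(\<Sum>v\<in>C. (b(u := b u + 1)) v) = (\<Sum>v\<in>C. b v + (if v = u then 1 else 0))"
        by (intro sum.cong) auto
      then show ?thesis
        using fin by (simp add: sum.distrib)
    qed
    then have "(\<Sum>u\<in>V. z ^ (\<Sum>v\<in>C. (b(u := b u + 1)) v)) =
        (\<Sum>u\<in>V. z ^ (\<Sum>v\<in>C. b v) * (1 + (z - 1) * (if u \<in> C then 1 else 0)))"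
      by (intro sum.cong) auto
    also have "\<dots> = z ^ (\<Sum>v\<in>C. b v) * (card V + (z - 1) * card C)"
      using assms(1,3)
      by (simp add: sum.distrib Int_absorb1 flip: sum_distrib_left sum.inter_restrict)
    finally show ?thesis
      using assms by (simp add: field_simps)
  qed
  then show ?case
    using Suc by (simp add: expectation_births_Suc[OF assms(1,2)] del: births.simps)
qed simp

text \<open>Markov's inequality for \<open>z ^ (\<Sum>v\<in>C. b v)\<close> with \<open>z = 1 / \<epsilon>\<close>.\<close>

lemma prob_births_ge_card:
  fixes \<epsilon> :: real
  assumes "finite V" "V \<noteq> {}" "C \<subseteq> V" "0 < \<epsilon>" "\<epsilon> \<le> 1" "real m \<le> \<epsilon> * card V"
  shows "measure_pmf.prob (births V m) {b. card C \<le> (\<Sum>v\<in>C. b v)} \<le> (exp 1 * \<epsilon>) ^ card C"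
proof -
  define z where "z = 1 / \<epsilon>"
  have z: "1 \<le> z"
    using assms by (simp add: z_def)
  have V: "0 < real (card V)"
    using assms by (simp add: card_gt_0_iff)
  have "measure_pmf.prob (births V m) {b. card C \<le> (\<Sum>v\<in>C. b v)} \<le>
      measure_pmf.expectation (births V m) (\<lambda>b. \<epsilon> ^ card C * z ^ (\<Sum>v\<in>C. b v))"
  proof (rule prob_le_expectation)
    fix b :: "'a \<Rightarrow> nat"
    assume "b \<in> {b. card C \<le> (\<Sum>v\<in>C. b v)}"
    then have "z ^ card C \<le> z ^ (\<Sum>v\<in>C. b v)"
      using z by (intro power_increasing) auto
    then show "1 \<le> \<epsilon> ^ card C * z ^ (\<Sum>v\<in>C. b v)"
      using assms(4) by (simp add: z_def field_simps)
  qed (use assms in \<open>auto simp: finite_set_pmf_births z_def\<close>)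
  also have "\<dots> = \<epsilon> ^ card C * (1 + (z - 1) * card C / card V) ^ m"
    using assms by (simp add: expectation_births_power)
  also have "(1 + (z - 1) * card C / card V) ^ m \<le> exp ((z - 1) * card C / card V) ^ m"
    using z by (intro power_mono exp_ge_add_one_self) auto
  also have "\<dots> = exp (real m * ((z - 1) * card C / card V))"
    by (simp only: exp_of_nat_mult)
  also have "\<dots> \<le> exp (real (card C))"
  proof -
    \<comment> \<open>The choice of \<open>z\<close> gives \<open>\<epsilon> * z = 1\<close>, so all
      factors but \<open>card C\<close> cancel.\<close>
    have "real m * ((z - 1) * card C / card V) \<le> (\<epsilon> * card V) * (z * card C / card V)"
      using assms z by (intro mult_mono divide_right_mono mult_right_mono) auto
    also have "\<dots> = real (card C)"
      using V assms(4) by (simp add: z_def)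
    finally show ?thesis
      by simp
  qed
  finally show ?thesis
    using assms(4) by (simp add: power_mult_distrib mult.commute flip: exp_of_nat_mult)
qed

section \<open>Connected sets and superlevel components\<close>

context graph
begin

text \<open>The index counts vertices, not edges, and vertices may repeat.\<close>

definition walks :: "nat \<Rightarrow> 'a list set" where
  "walks l = {p. length p = l \<and> set p \<subseteq> verts G \<and> successively (\<lambda>a b. b \<in> neighbours G a) p}"

lemma finite_walks: "finite (walks l)"
  unfolding walks_def
  by (rule finite_subset[OF _ finite_lists_length_eq[OF finite_verts, of l]]) auto

text \<open>The last vertex is free; going backwards, each earlier vertex is one of at most
  \<open>\<Delta>\<close> neighbours of its successor.\<close>

lemma card_walks_le:
  assumes "\<And>v. v \<in> verts G \<Longrightarrow> out_degree G v \<le> \<Delta>"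
  shows "card (walks (Suc l)) \<le> card (verts G) * \<Delta> ^ l"
proof (induction l)
  case 0
  have "walks (Suc 0) \<subseteq> (\<lambda>v. [v]) ` verts G"
    by (auto simp: walks_def length_Suc_conv)
  then show ?case
    by (metis card_image_le card_mono finite_imageI finite_verts mult.right_neutral order_trans power_0)
next
  case (Suc l)
  have "walks (Suc (Suc l)) \<subseteq> (\<Union>p \<in> walks (Suc l). (\<lambda>v. v # p) ` neighbours G (hd p))"
  proof
    fix q assume q: "q \<in> walks (Suc (Suc l))"
    then obtain v w p where "q = v # w # p"
      by (auto simp: walks_def length_Suc_conv)
    then have "w # p \<in> walks (Suc l)" "v \<in> neighbours G (hd (w # p))" "q = v # w # p"
      using q neighbours_sym by (auto simp: walks_def)
    then show "q \<in> (\<Union>p \<in> walks (Suc l). (\<lambda>v. v # p) ` neighbours G (hd p))"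
      by blast
  qed
  then have "card (walks (Suc (Suc l))) \<le>
      card (\<Union>p \<in> walks (Suc l). (\<lambda>v. v # p) ` neighbours G (hd p))"
    by (intro card_mono) (auto simp: finite_walks finite_neighbours)
  also have "\<dots> \<le> (\<Sum>p \<in> walks (Suc l). card ((\<lambda>v. v # p) ` neighbours G (hd p)))"
    by (rule card_UN_le[OF finite_walks])
  also have "\<dots> \<le> (\<Sum>p \<in> walks (Suc l). \<Delta>)"
  proof (rule sum_mono)
    fix p assume "p \<in> walks (Suc l)"
    then have "hd p \<in> verts G"
      by (auto simp: walks_def length_Suc_conv)
    then have "card (neighbours G (hd p)) \<le> \<Delta>"
      using assms card_neighbours_le order_trans by blast
    then show "card ((\<lambda>v. v # p) ` neighbours G (hd p)) \<le> \<Delta>"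
      using card_image_le[OF finite_neighbours] order_trans by blast
  qed
  also have "\<dots> \<le> card (verts G) * \<Delta> ^ Suc l"
    using Suc by (simp add: mult.assoc mult.commute[of \<Delta>] flip: mult.assoc)
  finally show ?case .
qed

text \<open>Connectedness from a root \<open>v\<close>, stated as the absence of a proper subset
  around \<open>v\<close> that no edge leaves within \<open>C\<close>. This is the form in which a
  traversal is grown; the root also makes \<open>C\<close> nonempty.\<close>

definition connected_sets :: "'a set set" where
  "connected_sets = {C. C \<subseteq> verts G \<and>
     (\<exists>v\<in>C. \<forall>W. v \<in> W \<longrightarrow> W \<subset> C \<longrightarrow> (\<exists>a\<in>W. \<exists>b\<in>C - W. b \<in> neighbours G a))}"

text \<open>A depth-first traversal of a spanning tree, built by inserting detours \<open>a, b, a\<close>.\<close>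

lemma connected_set_walk:
  assumes "C \<in> connected_sets"
  obtains p where "p \<in> walks (2 * card C - 1)" "set p = C"
proof -
  obtain v where v: "C \<subseteq> verts G" "v \<in> C"
    and grow: "\<And>W. v \<in> W \<Longrightarrow> W \<subset> C \<Longrightarrow> \<exists>a\<in>W. \<exists>b\<in>C - W. b \<in> neighbours G a"
    using assms by (auto simp: connected_sets_def)
  have fin: "finite C"
    using v finite_verts finite_subset by blast
  \<comment> \<open>Each detour adds two entries to the list and one new vertex to its set.\<close>
  have "\<exists>p. p \<in> walks (2 * j + 1) \<and> v \<in> set p \<and> set p \<subseteq> C \<and> card (set p) = Suc j"
    if "Suc j \<le> card C" for j
    using that
  proof (induction j)
    case 0
    then show ?case
      using v by (intro exI[of _ "[v]"]) (auto simp: walks_def)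
  next
    case (Suc j)
    then obtain p where p: "p \<in> walks (2 * j + 1)" "v \<in> set p" "set p \<subseteq> C" "card (set p) = Suc j"
      by auto
    with Suc.prems have "set p \<subset> C"
      by auto
    then obtain a b where ab: "a \<in> set p" "b \<in> C - set p" "b \<in> neighbours G a"
      using grow p(2) by meson
    then obtain xs ys where split: "p = xs @ a # ys"
      by (meson split_list)
    have "xs @ [a, b, a] @ ys \<in> walks (2 * Suc j + 1)"
      using p(1) ab v(1) neighbours_sym[of a b]
      by (auto simp: walks_def split successively_append_iff successively_Cons)
    moreover have "set (xs @ [a, b, a] @ ys) = insert b (set p)"
      by (auto simp: split)
    ultimately show ?case
      using p ab by (intro exI[of _ "xs @ [a, b, a] @ ys"]) auto
  qed
  from this[of "card C - 1"] obtain p where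
    "p \<in> walks (2 * (card C - 1) + 1)" "set p \<subseteq> C" "card (set p) = card C"
    using v(2) fin by (metis One_nat_def Suc_pred card_gt_0_iff empty_iff order_refl)
  moreover have "2 * (card C - 1) + 1 = 2 * card C - 1"
    using v(2) fin card_gt_0_iff[of C] by auto
  ultimately show ?thesis
    using that fin card_subset_eq by metis
qed

text \<open>A connected set is determined by its traversal, a walk with \<open>2 * s - 1\<close>
  entries. Rounding the bound up to an exact \<open>s\<close>-th power suits the later union
  bound.\<close>

lemma card_connected_sets_le:
  assumes "\<And>v. v \<in> verts G \<Longrightarrow> out_degree G v \<le> \<Delta>" "0 < s"
  shows "card {C \<in> connected_sets. card C = s} \<le> card (verts G) * ((\<Delta> + 1)\<^sup>2) ^ s"
proof -
  have "{C \<in> connected_sets. card C = s} \<subseteq> set ` walks (2 * s - 1)"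
    using connected_set_walk by blast
  then have "card {C \<in> connected_sets. card C = s} \<le> card (walks (2 * s - 1))"
    by (meson card_image_le card_mono finite_imageI finite_walks order_trans)
  also have "\<dots> \<le> card (verts G) * \<Delta> ^ (2 * s - 2)"
  proof -
    have "2 * s - 1 = Suc (2 * s - 2)"
      using assms(2) by simp
    then show ?thesis
      using card_walks_le[OF assms(1), of "2 * s - 2"] by simp
  qed
  also have "\<Delta> ^ (2 * s - 2) \<le> (\<Delta> + 1) ^ (2 * s - 2)"
    by (intro power_mono) auto
  also have "\<dots> \<le> (\<Delta> + 1) ^ (2 * s)"
    by (intro power_increasing) auto
  finally show ?thesis
    by (simp add: power_mult)
qed

lemma finite_connected_sets: "finite connected_sets"
  by (rule finite_subset[of _ "Pow (verts G)"]) (auto simp: connected_sets_def)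

lemma card_connected_set_pos: "C \<in> connected_sets \<Longrightarrow> 0 < card C"
  using finite_subset[OF _ finite_verts] by (auto simp: connected_sets_def card_gt_0_iff)

text \<open>The bad event of a round. Outside it, every component above the maximum load at the
  start of the round has fewer than \<open>ln n\<close> vertices.\<close>

definition crowded_births :: "('a \<Rightarrow> nat) set" where
  "crowded_births =
     (\<Union>C \<in> {C \<in> connected_sets. ln (card (verts G)) \<le> card C}. {b. card C \<le> (\<Sum>v\<in>C. b v)})"

text \<open>A union bound by size: the sets of size \<open>s \<ge> ln n\<close> contribute at most
  \<open>n * exp (-3 * s) \<le> n / n ^ 3\<close>, and there are at most \<open>n\<close>
  sizes.\<close>

lemma prob_crowded_births:
  fixes \<epsilon> :: real
  assumes "verts G \<noteq> {}" "\<And>v. v \<in> verts G \<Longrightarrow> out_degree G v \<le> \<Delta>"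
    and "0 < \<epsilon>" "(real \<Delta> + 1)\<^sup>2 * (exp 1 * \<epsilon>) \<le> exp (-3)" "real m \<le> \<epsilon> * card (verts G)"
  shows "measure_pmf.prob (births (verts G) m) crowded_births \<le> 1 / card (verts G)"
proof -
  define n where "n = card (verts G)"
  have n: "0 < n"
    using assms(1) by (simp add: n_def card_gt_0_iff)
  define \<C> where "\<C> = {C \<in> connected_sets. ln n \<le> card C}"
  \<comment> \<open>Both factors in front of \<open>\<epsilon>\<close> in the smallness condition
    are at least one.\<close>
  have eps: "\<epsilon> \<le> 1"
  proof -
    have "\<epsilon> \<le> exp 1 * \<epsilon>"
      using assms(3) by (simp add: one_le_exp_iff)
    also have "\<dots> \<le> (real \<Delta> + 1)\<^sup>2 * (exp 1 * \<epsilon>)"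
      using assms(3) by (simp add: power2_eq_square algebra_simps)
    also have "\<dots> \<le> exp (-3)" by fact
    also have "\<dots> \<le> 1" by simp
    finally show ?thesis .
  qed
  have size: "\<C> \<subseteq> (\<Union>s \<in> {s \<in> {1..n}. ln n \<le> real s}. {C \<in> connected_sets. card C = s})"
  proof
    fix C assume "C \<in> \<C>"
    then have "C \<in> connected_sets" "ln n \<le> card C"
      by (auto simp: \<C>_def)
    moreover from this have "card C \<le> n"
      by (auto simp: connected_sets_def n_def intro!: card_mono)
    ultimately show "C \<in> (\<Union>s \<in> {s \<in> {1..n}. ln n \<le> real s}. {C \<in> connected_sets. card C = s})"
      using card_connected_set_pos[of C] by auto
  qed
  have "measure_pmf.prob (births (verts G) m) crowded_births \<le>
      (\<Sum>C\<in>\<C>. measure_pmf.prob (births (verts G) m) {b. card C \<le> (\<Sum>v\<in>C. b v)})"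
    unfolding crowded_births_def \<C>_def n_def
    by (rule measure_pmf.finite_measure_subadditive_finite) (use finite_connected_sets in auto)
  also have "\<dots> \<le> (\<Sum>C\<in>\<C>. (exp 1 * \<epsilon>) ^ card C)"
    using assms(1,3,5) eps
    by (intro sum_mono prob_births_ge_card) (auto simp: \<C>_def connected_sets_def)
  also have "\<dots> \<le> (\<Sum>C \<in> (\<Union>s \<in> {s \<in> {1..n}. ln n \<le> real s}. {C \<in> connected_sets. card C = s}).
      (exp 1 * \<epsilon>) ^ card C)"
    using size assms(3) finite_connected_sets by (intro sum_mono2) auto
  also have "\<dots> = (\<Sum>s \<in> {s \<in> {1..n}. ln n \<le> real s}.
      \<Sum>C \<in> {C \<in> connected_sets. card C = s}. (exp 1 * \<epsilon>) ^ card C)"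
    using finite_connected_sets by (intro sum.UNION_disjoint) auto
  also have "\<dots> = (\<Sum>s \<in> {s \<in> {1..n}. ln n \<le> real s}.
      card {C \<in> connected_sets. card C = s} * (exp 1 * \<epsilon>) ^ s)"
    by (intro sum.cong) auto
  also have "\<dots> \<le> (\<Sum>s \<in> {s \<in> {1..n}. ln n \<le> real s}. n * exp (-3 * ln n))"
  proof (rule sum_mono)
    fix s assume s: "s \<in> {s \<in> {1..n}. ln n \<le> real s}"
    have "real (card {C \<in> connected_sets. card C = s}) \<le> real (n * ((\<Delta> + 1)\<^sup>2) ^ s)"
      using card_connected_sets_le[OF assms(2), of s] s unfolding n_def of_nat_le_iff by auto
    then have "card {C \<in> connected_sets. card C = s} * (exp 1 * \<epsilon>) ^ s \<le>
        real (n * ((\<Delta> + 1)\<^sup>2) ^ s) * (exp 1 * \<epsilon>) ^ s"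
      using assms(3) by (intro mult_right_mono) auto
    also have "\<dots> = n * ((real \<Delta> + 1)\<^sup>2 * (exp 1 * \<epsilon>)) ^ s"
      by (simp add: power_mult_distrib add.commute)
    also have "\<dots> \<le> n * exp (-3) ^ s"
      using assms(3,4) by (intro mult_left_mono power_mono) auto
    also have "\<dots> = n * exp (-3 * s)"
      by (simp add: mult.commute flip: exp_of_nat_mult)
    also have "\<dots> \<le> n * exp (-3 * ln n)"
      using s by (intro mult_left_mono) auto
    finally show "card {C \<in> connected_sets. card C = s} * (exp 1 * \<epsilon>) ^ s \<le> n * exp (-3 * ln n)" .
  qed
  also have "\<dots> \<le> n * (n * exp (-3 * ln n))"
  proof -
    have "card {s \<in> {1..n}. ln n \<le> real s} \<le> card {1..n}"
      by (intro card_mono) auto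
    then show ?thesis
      by (simp add: mult_right_mono)
  qed
  also have "exp (-3 * ln n) = 1 / real n ^ 3"
  proof -
    have "exp (-3 * ln n) = inverse (exp (of_nat 3 * ln n))"
      by (simp flip: exp_minus)
    then show ?thesis
      using n unfolding exp_of_nat_mult by (simp add: field_simps)
  qed
  also have "n * (n * (1 / real n ^ 3)) = 1 / n"
    using n by (simp add: power3_eq_cube)
  finally show ?thesis
    by (simp add: n_def)
qed

section \<open>Components of superlevel sets and the growth of the maximum in one round\<close>

definition component_above :: "('a \<Rightarrow> nat) \<Rightarrow> nat \<Rightarrow> 'a \<Rightarrow> 'a set" where
  "component_above x k v = {w. (v, w) \<in> {(a, b). b \<in> neighbours G a \<and> k < x b}\<^sup>*}"

lemma component_above_self: "v \<in> component_above x k v"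
  by (simp add: component_above_def)

lemma component_above_closed:
  assumes "a \<in> component_above x k v" "w \<in> neighbours G a" "k < x w"
  shows "w \<in> component_above x k v"
  using assms by (auto simp: component_above_def intro: rtrancl_into_rtrancl)

text \<open>The relation tests the load only at the target of a step, so the root needs
  \<open>k < x v\<close> separately.\<close>

lemma component_above_subset:
  assumes "v \<in> verts G" "k < x v"
  shows "component_above x k v \<subseteq> {w \<in> verts G. k < x w}"
proof
  fix w assume "w \<in> component_above x k v"
  then have "(v, w) \<in> {(a, b). b \<in> neighbours G a \<and> k < x b}\<^sup>*"
    by (simp add: component_above_def)
  then show "w \<in> {w \<in> verts G. k < x w}"
    by induction (use assms neighbours_subset_verts in auto)
qed

text \<open>A subset containing the root that no edge leaves would, by induction along paths,
  contain everything reachable and hence not be proper.\<close>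

lemma component_above_connected:
  assumes "v \<in> verts G" "k < x v"
  shows "component_above x k v \<in> connected_sets"
proof -
  let ?C = "component_above x k v"
  have "\<exists>a\<in>W. \<exists>b\<in>?C - W. b \<in> neighbours G a" if "v \<in> W" "W \<subset> ?C" for W
  proof (rule ccontr)
    assume stuck: "\<not> ?thesis"
    have "w \<in> W" if "(v, w) \<in> {(a, b). b \<in> neighbours G a \<and> k < x b}\<^sup>*" for w
      using that
    proof induction
      case (step a b)
      then show ?case
        using stuck component_above_closed[of a x k v b] \<open>W \<subset> ?C\<close> by blast
    qed (use \<open>v \<in> W\<close> in simp)
    then show False
      using \<open>W \<subset> ?C\<close> by (auto simp: component_above_def)
  qed
  then show ?thesis
    using component_above_subset[of v k x] assms component_above_self[of v x k]
    unfolding connected_sets_def by blast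
qed

text \<open>
  Each step down in load from \<open>v\<close> to level \<open>k + 1\<close> multiplies the size of the superlevel set
  within the component by at least \<open>1 + \<alpha>\<close>, since by smoothness it absorbs its whole boundary.
\<close>

lemma card_component_above_ge:
  fixes \<alpha> :: real
  assumes "vertex_expander \<alpha> G" "0 < \<alpha>" "smooth G x" "v \<in> verts G" "k < x v"
    and "real (card (component_above x k v)) \<le> card (verts G) / 2"
  shows "(1 + \<alpha>) ^ (x v - k - 1) \<le> card (component_above x k v)"
proof -
  let ?C = "component_above x k v"
  define T where "T j = {w \<in> ?C. j \<le> x w}" for j
  have C: "?C \<subseteq> verts G"
    using component_above_subset[of v k x] assms by auto
  have fin: "finite ?C"
    using C finite_verts finite_subset by blast
  have T_C: "T j \<subseteq> ?C" for j
    by (auto simp: T_def)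
  have "(1 + \<alpha>) ^ i \<le> card (T (x v - i))" if "i < x v - k" for i
    using that
  proof (induction i)
    case 0
    have "{v} \<subseteq> T (x v)"
      using component_above_self by (auto simp: T_def)
    then have "card {v} \<le> card (T (x v))"
      using finite_subset[OF T_C fin] by (intro card_mono)
    then show ?case by simp
  next
    case (Suc i)
    let ?S = "T (x v - i)"
    have S: "?S \<subseteq> verts G" "finite ?S"
      using T_C C fin finite_subset by blast+
    have "v \<in> ?S"
      using component_above_self by (auto simp: T_def)
    then have "1 \<le> card ?S"
      using S(2) by (metis One_nat_def Suc_leI card_gt_0_iff empty_iff)
    moreover have "real (card ?S) \<le> card (verts G) / 2"
      using assms(6) card_mono[OF fin T_C, of "x v - i"] by linarith
    ultimately have expand: "\<alpha> * card ?S \<le> card (vertex_boundary G ?S)"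
      using assms(1) S(1) by (auto simp: vertex_expander_def)
    \<comment> \<open>Smoothness lets the load drop by at most one across the boundary. As
      \<open>Suc i < x v - k\<close>, it stays above \<open>k\<close>, so closedness keeps the
      boundary inside the component.\<close>
    have "?S \<union> vertex_boundary G ?S \<subseteq> T (x v - Suc i)"
    proof
      fix w assume "w \<in> ?S \<union> vertex_boundary G ?S"
      then consider "w \<in> ?S" | a where "a \<in> ?S" "w \<in> neighbours G a"
        by (auto simp: vertex_boundary_def)
      then show "w \<in> T (x v - Suc i)"
      proof cases
        case 1
        then show ?thesis by (auto simp: T_def)
      next
        case 2
        then have "x a \<le> x w + 1" "a \<in> ?C" "x v - i \<le> x a"
          using assms(3) by (auto simp: smooth_def T_def)
        then show ?thesis
          using 2 Suc.prems component_above_closed[of a x k v w] by (auto simp: T_def)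
      qed
    qed
    then have "card (?S \<union> vertex_boundary G ?S) \<le> card (T (x v - Suc i))"
      using finite_subset[OF T_C fin] by (intro card_mono)
    moreover have "card (?S \<union> vertex_boundary G ?S) = card ?S + card (vertex_boundary G ?S)"
      using S by (intro card_Un_disjoint) (auto simp: vertex_boundary_def)
    ultimately have "(1 + \<alpha>) * card ?S \<le> card (T (x v - Suc i))"
      using expand by (simp add: algebra_simps)
    moreover have "(1 + \<alpha>) ^ Suc i \<le> (1 + \<alpha>) * card ?S"
      using Suc assms(2) by (simp add: mult_left_mono)
    ultimately show ?case by linarith
  qed
  from this[of "x v - k - 1"] have "(1 + \<alpha>) ^ (x v - k - 1) \<le> card (T (x v - (x v - k - 1)))"
    using assms(5) by simp
  also have "\<dots> \<le> card ?C"
    using card_mono[OF fin T_C] by simp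
  finally show ?thesis .
qed

text \<open>The component of \<open>v\<close> above \<open>k\<close> has excess at least one
  everywhere, hence at least as many births as vertices. Without crowding it is smaller than
  \<open>ln n\<close>, while expansion makes it exponentially large in \<open>y v - k - 1\<close>;
  taking logarithms gives the bound.\<close>

lemma load_increase_le:
  fixes \<alpha> :: real and k :: nat
  assumes "(y, b) \<in> set_pmf (loads_births G x m)" "b \<notin> crowded_births"
    and "vertex_expander \<alpha> G" "0 < \<alpha>" "smooth G x" "\<And>v. v \<in> verts G \<Longrightarrow> x v \<le> k"
    and "v \<in> verts G" "0 \<le> ln (ln (card (verts G)))"
  shows "real (y v) \<le> k + 1 + ln (ln (card (verts G))) / ln (1 + \<alpha>)"
proof (cases "k < y v")
  case True
  let ?C = "component_above y k v" and ?n = "card (verts G)"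
  have ne: "verts G \<noteq> {}"
    using assms(7) by auto
  have C: "?C \<subseteq> {w \<in> verts G. k < y w}"
    using component_above_subset[of v k y] assms(7) True by simp
  have fin: "finite ?C"
    using finite_subset[OF C] by simp
  have "card ?C = (\<Sum>w\<in>?C. 1)"
    by simp
  also have "\<dots> \<le> (\<Sum>w\<in>?C. y w - k)"
    using C by (intro sum_mono) (auto simp: Suc_le_eq)
  also have "\<dots> \<le> (\<Sum>w\<in>?C. b w)"
    using assms(1) ne assms(6) fin
  proof (rule excess_le_births)
    show "?C \<subseteq> verts G"
      using C by auto
  qed (use component_above_closed in auto)
  finally have "card ?C \<le> (\<Sum>w\<in>?C. b w)" .
  moreover have "?C \<in> connected_sets"
    using component_above_connected[of v k y] assms(7) True by simp
  ultimately have small: "real (card ?C) < ln ?n"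
    using assms(2) by (auto simp: crowded_births_def not_le)
  have "(1 + \<alpha>) ^ (y v - k - 1) \<le> card ?C"
  proof (rule card_component_above_ge)
    show "smooth G y"
      using smooth_loads_births[OF assms(1,5) ne] .
    show "real (card ?C) \<le> ?n / 2"
      using small ln_le_half[of ?n] by linarith
  qed (use assms True in auto)
  then have "(1 + \<alpha>) ^ (y v - k - 1) \<le> ln ?n"
    using small by linarith
  then have "ln ((1 + \<alpha>) ^ (y v - k - 1)) \<le> ln (ln ?n)"
    using assms(4) small by (subst ln_le_cancel_iff) auto
  then have "(y v - k - 1) * ln (1 + \<alpha>) \<le> ln (ln ?n)"
    using assms(4) by (simp add: ln_realpow)
  then have "real (y v - k - 1) \<le> ln (ln ?n) / ln (1 + \<alpha>)"
    using assms(4) by (simp add: field_simps)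
  then show ?thesis
    using True by (simp add: of_nat_diff)
next
  case False
  then have "real (y v) \<le> k"
    by simp
  also have "\<dots> \<le> k + 1 + ln (ln (card (verts G))) / ln (1 + \<alpha>)"
    using assms(4,8) by simp
  finally show ?thesis .
qed

end

section \<open>A vertex with many births\<close>

text \<open>The truncated exponential series, i.e. the exponential generating function of fewer than
  \<open>K\<close> births at one vertex.\<close>

definition exp_poly :: "nat \<Rightarrow> real poly" where
  "exp_poly K = (\<Sum>j<K. monom (1 / fact j) j)"

lemma coeff_exp_poly: "coeff (exp_poly K) i = (if i < K then 1 / fact i else 0)"
  by (simp add: exp_poly_def coeff_sum if_distrib cong: if_cong)

text \<open>Differentiation mirrors a birth: the remaining capacity drops by one. At
  \<open>K = 0\<close> both sides are the zero polynomial.\<close>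

lemma pderiv_exp_poly: "pderiv (exp_poly K) = exp_poly (K - 1)"
proof (rule poly_eqI)
  fix i
  have "of_nat (Suc i) * (1 / fact (Suc i)) = (1 / fact i :: real)"
    by (simp add: fact_Suc del: of_nat_Suc)
  then show "coeff (pderiv (exp_poly K)) i = coeff (exp_poly (K - 1)) i"
    unfolding coeff_pderiv coeff_exp_poly by auto
qed

text \<open>The gap is the first omitted term of the series of \<open>exp 1\<close>; the later terms
  are positive.\<close>

lemma poly_exp_poly_le: "poly (exp_poly K) 1 \<le> exp 1 - 1 / fact K"
proof -
  have "(\<Sum>j<Suc K. inverse (fact j) * (1::real) ^ j) \<le> (\<Sum>j. inverse (fact j) * 1 ^ j)"
    using summable_exp[of "1::real"] by (intro sum_le_suminf) auto
  also have "\<dots> = exp 1"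
    by (simp add: exp_def divide_inverse mult.commute scaleR_conv_of_real)
  finally show ?thesis
    by (simp add: exp_poly_def poly_sum poly_monom divide_inverse)
qed

lemma poly_exp_poly_nonneg: "0 \<le> poly (exp_poly K) 1"
  by (simp add: exp_poly_def poly_sum poly_monom sum_nonneg)

lemma coeff_mult_nonneg:
  fixes p q :: "'a :: linordered_idom poly"
  assumes "\<And>i. 0 \<le> coeff p i" "\<And>i. 0 \<le> coeff q i"
  shows "0 \<le> coeff (p * q) i"
  using assms by (auto simp: coeff_mult intro!: sum_nonneg)

lemma coeff_power_nonneg:
  fixes p :: "'a :: linordered_idom poly"
  assumes "\<And>i. 0 \<le> coeff p i"
  shows "0 \<le> coeff (p ^ n) i"
proof (induction n arbitrary: i)
  case (Suc n)
  then show ?case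
    unfolding power_Suc using assms by (intro coeff_mult_nonneg)
qed auto

lemma coeff_0_prod:
  fixes f :: "'b \<Rightarrow> 'a :: comm_semiring_1 poly"
  shows "coeff (prod f A) 0 = (\<Prod>a\<in>A. coeff (f a) 0)"
  by (simp add: poly_prod flip: poly_0_coeff_0)

lemma coeff_le_poly_1:
  fixes p :: "'a :: linordered_idom poly"
  assumes "\<And>i. 0 \<le> coeff p i"
  shows "coeff p i \<le> poly p 1"
proof (cases "i \<le> degree p")
  case True
  have "coeff p i \<le> (\<Sum>j\<le>degree p. coeff p j)"
    using True assms by (intro member_le_sum) auto
  then show ?thesis
    by (simp add: poly_altdef)
next
  case False
  then show ?thesis
    using assms by (auto simp: coeff_eq_0 poly_altdef intro!: sum_nonneg)
qed

text \<open>
  The quantity \<open>t! [x ^ t] (\<Prod>v. exp_poly (K - b v)) / n ^ t\<close> is the probability that \<open>t\<close> further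
  births keep all counts below \<open>K\<close>, given the counts \<open>b\<close>; the product rule for \<^const>\<open>pderiv\<close> makes
  it a martingale along the births.
\<close>

lemma expectation_births_coeff:
  assumes "finite V" "V \<noteq> {}"
  shows "measure_pmf.expectation (births V m)
      (\<lambda>b. fact t / card V ^ t * coeff (\<Prod>v\<in>V. exp_poly (K - b v)) t) =
    fact (t + m) / card V ^ (t + m) * coeff (exp_poly K ^ card V) (t + m)"
proof (induction m arbitrary: t)
  case (Suc m)
  have step: "(\<Sum>u\<in>V. fact t / card V ^ t *
        coeff (\<Prod>v\<in>V. exp_poly (K - (b(u := b u + 1)) v)) t) / card V =
      fact (Suc t) / card V ^ Suc t * coeff (\<Prod>v\<in>V. exp_poly (K - b v)) (Suc t)" for b
  proof -
    \<comment> \<open>A birth at \<open>u\<close> differentiates the factor of \<open>u\<close>;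
      summing over \<open>u\<close> yields the product rule.\<close>
    have "(\<Prod>v\<in>V. exp_poly (K - (b(u := b u + 1)) v)) =
        (\<Prod>v\<in>V - {u}. exp_poly (K - b v)) * pderiv (exp_poly (K - b u))" if "u \<in> V" for u
    proof -
      have "(\<Prod>v\<in>V. exp_poly (K - (b(u := b u + 1)) v)) =
          exp_poly (K - (b u + 1)) * (\<Prod>v\<in>V - {u}. exp_poly (K - (b(u := b u + 1)) v))"
        using assms(1) that by (subst prod.remove[of _ u]) auto
      also have "(\<Prod>v\<in>V - {u}. exp_poly (K - (b(u := b u + 1)) v)) =
          (\<Prod>v\<in>V - {u}. exp_poly (K - b v))"
        by (intro prod.cong) auto
      finally show ?thesis
        by (simp add: pderiv_exp_poly mult.commute)
    qed
    then have "(\<Sum>u\<in>V. \<Prod>v\<in>V. exp_poly (K - (b(u := b u + 1)) v)) =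
        pderiv (\<Prod>v\<in>V. exp_poly (K - b v))"
      by (simp add: pderiv_prod)
    \<comment> \<open>The factor \<open>Suc t\<close> from the derivative turns
      \<open>fact t\<close> into \<open>fact (Suc t)\<close>.\<close>
    then have "(\<Sum>u\<in>V. coeff (\<Prod>v\<in>V. exp_poly (K - (b(u := b u + 1)) v)) t) =
        Suc t * coeff (\<Prod>v\<in>V. exp_poly (K - b v)) (Suc t)"
      by (simp only: coeff_pderiv flip: coeff_sum)
    then show ?thesis
      unfolding sum_distrib_left[symmetric] by (simp add: mult_ac)
  qed
  show ?case
    unfolding expectation_births_Suc[OF assms] step Suc by simp
qed simp

text \<open>At \<open>t = 0\<close> the martingale is the indicator of the event, since
  \<open>exp_poly (K - b v)\<close> has constant term one if \<open>b v < K\<close> and zero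
  otherwise. Its initial value is a single coefficient, bounded by the value of the polynomial at
  one.\<close>

lemma prob_births_less:
  assumes "finite V" "V \<noteq> {}"
  shows "measure_pmf.prob (births V m) {b. \<forall>v\<in>V. b v < K} \<le>
    fact m / card V ^ m * (exp 1 - 1 / fact K) ^ card V"
proof -
  have nonneg: "0 \<le> coeff (exp_poly i) j" for i j
    by (simp add: coeff_exp_poly)
  have "measure_pmf.prob (births V m) {b. \<forall>v\<in>V. b v < K} \<le>
      measure_pmf.expectation (births V m)
        (\<lambda>b. fact 0 / card V ^ 0 * coeff (\<Prod>v\<in>V. exp_poly (K - b v)) 0)"
    using finite_set_pmf_births[OF assms]
    by (intro prob_le_expectation)
       (auto simp: coeff_0_prod coeff_exp_poly intro!: prod_nonneg prod_ge_1)
  also have "\<dots> = fact m / card V ^ m * coeff (exp_poly K ^ card V) m"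
    using expectation_births_coeff[OF assms, of m 0 K] by simp
  also have "\<dots> \<le> fact m / card V ^ m * poly (exp_poly K ^ card V) 1"
    by (intro mult_left_mono coeff_le_poly_1 coeff_power_nonneg nonneg) auto
  also have "\<dots> \<le> fact m / card V ^ m * (exp 1 - 1 / fact K) ^ card V"
    unfolding poly_power
    by (intro mult_left_mono power_mono poly_exp_poly_le poly_exp_poly_nonneg) auto
  finally show ?thesis .
qed

text \<open>A Stirling-type bound. The induction step amounts to
  \<open>exp 1 \<le> ((n + 1) / n) ^ Suc n\<close>, which follows from
  \<open>ln t \<le> t - 1\<close> at \<open>t = n / (n + 1)\<close>.\<close>

lemma fact_le_power_div_exp:
  assumes "0 < n"
  shows "fact n * exp (real n) \<le> exp 1 * n * real n ^ n"
  using assms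
proof (induction n rule: nat_induct_non_zero)
  case (Suc n)
  have "ln (n / (n + 1)) \<le> n / (n + 1) - 1"
    using Suc by (intro ln_le_minus_one) auto
  also have "\<dots> = - (1 / (n + 1))"
    by (simp add: field_simps)
  finally have "1 / (n + 1) \<le> ln ((n + 1) / n)"
    using Suc by (simp add: ln_div)
  then have "1 \<le> Suc n * ln ((n + 1) / n)"
    by (simp add: field_simps)
  then have "exp 1 \<le> exp (Suc n * ln ((n + 1) / n))"
    by simp
  also have "\<dots> = ((n + 1) / n) ^ Suc n"
    using Suc unfolding exp_of_nat_mult by simp
  finally have e: "exp 1 * real n ^ Suc n \<le> (n + 1) ^ Suc n"
    using Suc by (simp add: field_simps)
  have "fact (Suc n) * exp (real (Suc n)) = (n + 1) * exp 1 * (fact n * exp (real n))"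
    by (simp add: exp_add)
  also have "\<dots> \<le> (n + 1) * exp 1 * (exp 1 * n * real n ^ n)"
    using Suc by (intro mult_left_mono) auto
  also have "\<dots> = exp 1 * (n + 1) * (exp 1 * real n ^ Suc n)"
    by simp
  also have "\<dots> \<le> exp 1 * (n + 1) * (n + 1) ^ Suc n"
    using e by (intro mult_left_mono) auto
  also have "\<dots> = exp 1 * real (Suc n) * real (Suc n) ^ Suc n"
    by (simp only: of_nat_Suc of_nat_add of_nat_1 of_nat_power add.commute)
  finally show ?case .
qed simp

text \<open>With \<open>n\<close> births, Stirling's factor \<open>exp (- n)\<close> cancels the
  power of \<open>exp 1\<close>; what remains is \<open>(1 - 1 / (exp 1 * fact K)) ^ n\<close>, up
  to the factor \<open>exp 1 * n\<close>.\<close>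

lemma prob_births_card_less:
  assumes "finite V" "V \<noteq> {}"
  shows "measure_pmf.prob (births V (card V)) {b. \<forall>v\<in>V. b v < K} \<le>
    exp 1 * card V * exp (- (card V / (exp 1 * fact K)))"
proof -
  define n where "n = card V"
  have n: "0 < n"
    using assms by (simp add: n_def card_gt_0_iff)
  have "exp 1 - 1 / fact K = exp 1 * (1 + - (1 / (exp 1 * fact K)) :: real)"
    by (simp add: field_simps)
  also have "\<dots> \<le> exp 1 * exp (- (1 / (exp 1 * fact K)))"
    by (intro mult_left_mono exp_ge_add_one_self) auto
  finally have "(exp 1 - 1 / fact K :: real) ^ n \<le> (exp 1 * exp (- (1 / (exp 1 * fact K)))) ^ n"
    using poly_exp_poly_le[of K] poly_exp_poly_nonneg[of K] by (intro power_mono) linarith+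
  also have "\<dots> = exp (real n) * exp (- (n / (exp 1 * fact K)))"
    by (simp add: power_mult_distrib flip: exp_of_nat_mult)
  finally have "fact n / n ^ n * (exp 1 - 1 / fact K) ^ n \<le>
      fact n / n ^ n * (exp (real n) * exp (- (n / (exp 1 * fact K))))"
    by (intro mult_left_mono) auto
  also have "\<dots> = fact n * exp (real n) / n ^ n * exp (- (n / (exp 1 * fact K)))"
    by simp
  also have "\<dots> \<le> exp 1 * n * exp (- (n / (exp 1 * fact K)))"
    using fact_le_power_div_exp[OF n] n by (intro mult_right_mono) (auto simp: divide_simps)
  finally show ?thesis
    using prob_births_less[OF assms, of n K] by (simp add: n_def)
qed

section \<open>The maximum load\<close>

context graph
begin

lemma max_load_le_iff:
  "verts G \<noteq> {} \<Longrightarrow> max_load G x \<le> k \<longleftrightarrow> (\<forall>v\<in>verts G. x v \<le> k)"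
  by (simp add: max_load_def)

lemma loads_eq: "loads G i = map_pmf fst (loads_births G (\<lambda>_. 0) i)"
  using loads_add[of G 0 i] by (simp add: bind_return_pmf)

lemma prob_max_load_le:
  assumes "verts G \<noteq> {}" "\<And>v. v \<in> verts G \<Longrightarrow> out_degree G v \<le> \<Delta>" "r * (\<Delta> + 1) ^ r < K"
  shows "measure_pmf.prob (loads G m) {x. max_load G x \<le> r} \<le>
    measure_pmf.prob (births (verts G) m) {b. \<forall>v\<in>verts G. b v < K}"
proof -
  have "b v < K" if "(y, b) \<in> set_pmf (loads_births G (\<lambda>_. 0) m)" "\<forall>v\<in>verts G. y v \<le> r"
    "v \<in> verts G" for y b v
    using births_le_power[of y b "\<lambda>_. 0" m v r \<Delta>] that assms by (meson le_less_trans)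
  then show ?thesis
    unfolding loads_eq births_loads_births[of G "\<lambda>_. 0", symmetric] measure_map_pmf
    by (intro measure_pmf.finite_measure_mono_AE)
       (auto simp: AE_measure_pmf_iff max_load_le_iff[OF assms(1)])
qed

text \<open>Outside \<open>crowded_births\<close> the maximum rises by at most \<open>H\<close>, and
  that event depends on the births alone.\<close>

lemma prob_round:
  fixes \<epsilon> \<alpha> :: real
  defines "n \<equiv> card (verts G)"
  assumes "verts G \<noteq> {}" "\<And>v. v \<in> verts G \<Longrightarrow> out_degree G v \<le> \<Delta>"
    and "0 < \<epsilon>" "(real \<Delta> + 1)\<^sup>2 * (exp 1 * \<epsilon>) \<le> exp (-3)" "real m \<le> \<epsilon> * n"
    and "vertex_expander \<alpha> G" "0 < \<alpha>" "0 \<le> ln (ln n)" "1 + ln (ln n) / ln (1 + \<alpha>) \<le> real H"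
    and "smooth G x" "max_load G x \<le> k"
  shows "measure_pmf.prob (map_pmf fst (loads_births G x m)) {y. k + H < max_load G y} \<le> 1 / n"
proof -
  have "max_load G y \<le> k + H"
    if "(y, b) \<in> set_pmf (loads_births G x m)" "b \<notin> crowded_births" for y b
  proof -
    have "y v \<le> k + H" if "v \<in> verts G" for v
    proof -
      have "real (y v) \<le> k + 1 + ln (ln n) / ln (1 + \<alpha>)"
        unfolding n_def using assms that max_load_le_iff[OF assms(2), of x k]
          \<open>(y, b) \<in> _\<close> \<open>b \<notin> _\<close>
        by (intro load_increase_le[of y b x m]) auto
      also have "\<dots> \<le> real (k + H)"
        using assms(10) by simp
      finally show ?thesis
        unfolding of_nat_le_iff .
    qed
    then show ?thesis
      using max_load_le_iff[OF assms(2)] by blast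
  qed
  then have "measure_pmf.prob (map_pmf fst (loads_births G x m)) {y. k + H < max_load G y} \<le>
      measure_pmf.prob (births (verts G) m) crowded_births"
    unfolding births_loads_births[of G x, symmetric] measure_map_pmf
    by (intro measure_pmf.finite_measure_mono_AE) (force simp: AE_measure_pmf_iff)+
  also have "\<dots> \<le> 1 / n"
    using prob_crowded_births assms unfolding n_def by blast
  finally show ?thesis .
qed

lemma prob_rounds:
  fixes \<epsilon> \<alpha> :: real
  defines "n \<equiv> card (verts G)"
  assumes "verts G \<noteq> {}" "\<And>v. v \<in> verts G \<Longrightarrow> out_degree G v \<le> \<Delta>"
    and "0 < \<epsilon>" "(real \<Delta> + 1)\<^sup>2 * (exp 1 * \<epsilon>) \<le> exp (-3)" "real m \<le> \<epsilon> * n"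
    and "vertex_expander \<alpha> G" "0 < \<alpha>" "0 \<le> ln (ln n)" "1 + ln (ln n) / ln (1 + \<alpha>) \<le> real H"
    and "j \<le> k * m"
  shows "measure_pmf.prob (loads G j) {x. k * H < max_load G x} \<le> k / n"
  using assms(11)
proof (induction k arbitrary: j)
  case 0
  have "max_load G (\<lambda>_. 0) = 0"
    using max_load_le_iff[OF assms(2), of "\<lambda>_. 0" 0] by simp
  then show ?case
    using 0 by simp
next
  case (Suc k)
  \<comment> \<open>The length of the last round; the remaining \<open>j - i\<close> balls fit into
    \<open>k\<close> rounds.\<close>
  define i where "i = min j m"
  have i: "j - i \<le> k * m" "i \<le> m" "j - i + i = j"
    using Suc.prems by (auto simp: i_def)
  have fin: "finite (set_pmf (loads G i))" for i
    by (simp add: loads_eq finite_set_pmf_loads_births[OF assms(2)])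
  have "measure_pmf.prob (loads G (j - i + i)) {x. k * H + H < max_load G x} \<le>
      measure_pmf.prob (loads G (j - i)) {x. k * H < max_load G x} + 1 / n"
    unfolding loads_add
  proof (rule prob_bind_pmf_le[OF fin])
    fix x assume "x \<in> set_pmf (loads G (j - i))" "x \<notin> {x. k * H < max_load G x}"
    then show "measure_pmf.prob (map_pmf fst (loads_births G x i)) {x. k * H + H < max_load G x} \<le>
        1 / n"
      unfolding n_def using assms i smooth_loads
      by (intro prob_round[where \<epsilon> = \<epsilon> and \<alpha> = \<alpha> and \<Delta> = \<Delta>]) (auto intro: order_trans[of _ "real m"])
  qed (auto simp: finite_set_pmf_loads_births[OF assms(2)])
  also have "\<dots> \<le> k / n + 1 / n"
    using Suc.IH[OF i(1)] by simp
  finally show ?case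
    unfolding i(3) by (simp add: add_divide_distrib add.commute)
qed

end

lemma (in graph) prob_max_load_between:
  fixes \<epsilon> \<alpha> :: real
  defines "n \<equiv> card (verts G)"
  assumes "\<And>v. v \<in> verts G \<Longrightarrow> out_degree G v \<le> \<Delta>" "vertex_expander \<alpha> G" "0 < \<alpha>"
    and "0 < \<epsilon>" "(real \<Delta> + 1)\<^sup>2 * (exp 1 * \<epsilon>) \<le> exp (-3)"
    and "1 \<le> \<epsilon> * n" "1 \<le> ln (ln n)"
  defines "R \<equiv> nat \<lceil>2 / \<epsilon>\<rceil>"
    and "K \<equiv> nat \<lceil>sqrt (ln n)\<rceil>"
  shows "1 - (R / n + exp 1 * n * exp (- (n / (exp 1 * fact K)))) \<le>
    measure_pmf.prob (loads G n)
      {x. 1 / (2 * ln (2 * (real \<Delta> + 1))) * ln (ln n) \<le> real (max_load G x) \<and>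
          real (max_load G x) \<le> R * (2 + 1 / ln (1 + \<alpha>)) * ln (ln n)}"
    (is "_ \<le> measure_pmf.prob _ {x. ?c * _ \<le> _ \<and> _}")
proof -
  have n: "0 < n"
    using assms(7) by (cases "n = 0") auto
  then have ne: "verts G \<noteq> {}"
    by (auto simp: n_def)
  define L where "L = ln (ln n)"
  have L: "1 \<le> L"
    using assms(8) by (simp add: L_def)
  have ln_n: "0 < ln n"
  proof (rule ccontr)
    assume "\<not> 0 < ln n"
    moreover have "0 \<le> ln n"
      using n by simp
    ultimately have "ln n = 0"
      by linarith
    then show False
      using assms(8) by simp
  qed
  have c: "0 < ?c"
    by simp
  \<comment> \<open>The constant is tuned so that
    \<open>(2 * (\<Delta> + 1)) powr (?c * L) = sqrt (ln n)\<close>; the base \<open>2\<close>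
    absorbs the factor \<open>r < 2 ^ r\<close>.\<close>
  define r where "r = nat \<lfloor>?c * L\<rfloor>"
  define H where "H = nat \<lceil>1 + L / ln (1 + \<alpha>)\<rceil>"
  \<comment> \<open>Since \<open>1 \<le> \<epsilon> * n\<close>, rounding down loses at most half,
    so \<open>R\<close> rounds of \<open>m\<close> balls cover all \<open>n\<close> balls.\<close>
  define m where "m = nat \<lfloor>\<epsilon> * n\<rfloor>"
  have "real (r * (\<Delta> + 1) ^ r) < 2 ^ r * (real \<Delta> + 1) ^ r"
    by (simp add: add.commute)
  also have "\<dots> = (2 * (real \<Delta> + 1)) powr r"
    by (subst powr_realpow) (simp_all only: power_mult_distrib, simp)
  also have "\<dots> \<le> (2 * (real \<Delta> + 1)) powr (?c * L)"
    using c L by (intro powr_mono) (auto simp: r_def)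
  also have "\<dots> = sqrt (ln n)"
  proof -
    have "(2 * (real \<Delta> + 1)) powr (?c * L) = exp (L / 2)"
      by (simp add: powr_def)
    also have "\<dots> = sqrt (ln n)"
      using ln_n by (simp add: L_def powr_half_sqrt[symmetric] powr_def)
    finally show ?thesis .
  qed
  also have "\<dots> \<le> real K"
    unfolding K_def by (rule real_nat_ceiling_ge)
  finally have r: "r * (\<Delta> + 1) ^ r < K"
    unfolding of_nat_less_iff .
  have lower: "measure_pmf.prob (loads G n) {x. max_load G x \<le> r} \<le>
      exp 1 * n * exp (- (n / (exp 1 * fact K)))"
    using order_trans[OF prob_max_load_le[OF ne assms(2) r] prob_births_card_less[OF finite_verts ne]]
    by (simp add: n_def)
  have "1 \<le> m"
    using assms(7) by (simp add: m_def le_nat_iff)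
  moreover have "real m \<le> \<epsilon> * n" "\<epsilon> * n < real m + 1"
    using assms(7) by (simp_all add: m_def)
  ultimately have m: "real m \<le> \<epsilon> * n" "\<epsilon> * n / 2 \<le> m"
    by linarith+
  have "real n = 2 / \<epsilon> * (\<epsilon> * n / 2)"
    using assms(5) by simp
  also have "\<dots> \<le> real R * real m"
    using assms(5) m(2) unfolding R_def
    by (intro mult_mono real_nat_ceiling_ge of_nat_0_le_iff) auto
  finally have Rm: "n \<le> R * m"
    unfolding of_nat_mult[symmetric] of_nat_le_iff .
  have upper: "measure_pmf.prob (loads G n) {x. R * H < max_load G x} \<le> R / n"
    unfolding n_def
  proof (rule prob_rounds[where \<epsilon> = \<epsilon> and \<alpha> = \<alpha> and m = m and \<Delta> = \<Delta>])
    show "1 + ln (ln (card (verts G))) / ln (1 + \<alpha>) \<le> H"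
      unfolding H_def L_def n_def by (rule real_nat_ceiling_ge)
    show "card (verts G) \<le> R * m"
      using Rm by (simp add: n_def)
  qed (use assms ne m(1) in auto)
  have "real H \<le> 2 + L / ln (1 + \<alpha>)"
  proof -
    have "0 \<le> L / ln (1 + \<alpha>)"
      using assms(4) L by simp
    then show ?thesis
      using ceiling_correct[of "1 + L / ln (1 + \<alpha>)"] by (simp add: H_def)
  qed
  \<comment> \<open>\<open>1 \<le> L\<close> absorbs the additive constant.\<close>
  also have "\<dots> \<le> (2 + 1 / ln (1 + \<alpha>)) * L"
    using L by (simp add: distrib_right)
  finally have H: "R * H \<le> R * (2 + 1 / ln (1 + \<alpha>)) * L"
    by (simp add: mult_left_mono mult.assoc)
  have r_ge: "?c * L \<le> real k" if "r < k" for k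
  proof -
    have "0 \<le> ?c * L"
      using L by simp
    then have "?c * L < real r + 1"
      unfolding r_def by (simp only: of_nat_nat zero_le_floor real_of_int_floor_add_one_gt)
    then show ?thesis
      using that by linarith
  qed
  have "- {x. ?c * L \<le> real (max_load G x) \<and>
        real (max_load G x) \<le> R * (2 + 1 / ln (1 + \<alpha>)) * L} \<subseteq>
      {x. max_load G x \<le> r} \<union> {x. R * H < max_load G x}"
  proof
    fix x
    assume x: "x \<in> - {x. ?c * L \<le> real (max_load G x) \<and>
        real (max_load G x) \<le> R * (2 + 1 / ln (1 + \<alpha>)) * L}"
    show "x \<in> {x. max_load G x \<le> r} \<union> {x. R * H < max_load G x}"
    proof (rule ccontr)
      assume "\<not> ?thesis"
      then have "r < max_load G x" "max_load G x \<le> R * H"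
        by auto
      then have "?c * L \<le> real (max_load G x)" "real (max_load G x) \<le> real (R * H)"
        using r_ge by (blast, simp only: of_nat_le_iff)
      then show False
        using x H by auto
    qed
  qed
  then have "measure_pmf.prob (loads G n) (- {x. ?c * L \<le> real (max_load G x) \<and>
        real (max_load G x) \<le> R * (2 + 1 / ln (1 + \<alpha>)) * L}) \<le>
      measure_pmf.prob (loads G n) ({x. max_load G x \<le> r} \<union> {x. R * H < max_load G x})"
    by (intro measure_pmf.finite_measure_mono) auto
  also have "\<dots> \<le> measure_pmf.prob (loads G n) {x. max_load G x \<le> r} +
      measure_pmf.prob (loads G n) {x. R * H < max_load G x}"
    by (rule measure_Un_le) auto
  also have "\<dots> \<le> exp 1 * n * exp (- (n / (exp 1 * fact K))) + R / n"
    using lower upper by (rule add_mono)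
  finally show ?thesis
    using measure_pmf.prob_compl[of "{x. ?c * L \<le> real (max_load G x) \<and>
        real (max_load G x) \<le> R * (2 + 1 / ln (1 + \<alpha>)) * L}" "loads G n"]
    by (simp add: L_def Compl_eq_Diff_UNIV)
qed

section \<open>Asymptotics in the number of vertices\<close>

text \<open>\<open>fact K \<le> K ^ K = exp (K * ln K)\<close>, and for \<open>K\<close> of order
  \<open>sqrt (ln n)\<close> the exponent is of smaller order than \<open>ln n\<close>.\<close>

lemma fact_ceiling_sqrt_ln_le:
  "eventually (\<lambda>n. fact (nat \<lceil>sqrt (ln (real n))\<rceil>) \<le> sqrt (real n)) sequentially"
proof -
  have "eventually (\<lambda>n. (sqrt (ln (real n)) + 1) * ln (sqrt (ln (real n)) + 1) \<le> ln (real n) / 2)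
      sequentially"
    by real_asymp
  moreover have "eventually (\<lambda>n. 3 \<le> n) sequentially"
    by (rule eventually_ge_at_top)
  ultimately show ?thesis
  proof eventually_elim
    case (elim n)
    define K where "K = nat \<lceil>sqrt (ln (real n))\<rceil>"
    have "0 < sqrt (ln (real n))"
      using elim by simp
    moreover from this have "real K = \<lceil>sqrt (ln (real n))\<rceil>"
      by (simp add: K_def)
    ultimately have K: "1 \<le> real K" "real K \<le> sqrt (ln (real n)) + 1"
      using ceiling_correct[of "sqrt (ln (real n))"] by auto
    have "fact K \<le> (real K ^ K :: real)"
      using fact_le_power[of K] by simp
    also have "\<dots> = exp (K * ln K)"
      using K(1) unfolding exp_of_nat_mult by simp
    also have "K * ln K \<le> (sqrt (ln (real n)) + 1) * ln (sqrt (ln (real n)) + 1)"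
      using K by (intro mult_mono) auto
    also have "\<dots> \<le> ln (real n) / 2"
      by fact
    also have "exp (ln (real n) / 2) = sqrt (real n)"
      using elim by (simp add: powr_half_sqrt[symmetric] powr_def)
    finally show ?case
      by (simp add: K_def)
  qed
qed

theorem theorem1p1:
  fixes G :: "nat \<Rightarrow> ('v, 'e) pre_digraph" and I :: "nat set" and \<Delta> :: nat
  assumes "infinite I"
    and "\<And>n. n \<in> I \<Longrightarrow> graph (G n)"
    and "\<And>n. n \<in> I \<Longrightarrow> Digraph_Component.connected (G n)"
    and "\<And>n. n \<in> I \<Longrightarrow> card (verts (G n)) = n"
    and "\<And>n v. n \<in> I \<Longrightarrow> v \<in> verts (G n) \<Longrightarrow> out_degree (G n) v \<le> \<Delta>"
    and "expander_family (G ` I)"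
  shows "\<exists>c C :: real. 0 < c \<and> c \<le> C \<and>
    ((\<lambda>n. measure_pmf.prob (loads (G n) n)
        {x. c * ln (ln (real n)) \<le> real (max_load (G n) x) \<and>
            real (max_load (G n) x) \<le> C * ln (ln (real n))})
      \<longlongrightarrow> 1) (inf sequentially (principal I))"
proof -
  obtain \<alpha> where \<alpha>: "0 < \<alpha>" "\<And>n. n \<in> I \<Longrightarrow> vertex_expander \<alpha> (G n)"
    using assms(6) by (auto simp: expander_family_def)
  \<comment> \<open>Chosen so that the smallness condition of \<open>prob_crowded_births\<close>
    holds with equality.\<close>
  define \<epsilon> where "\<epsilon> = exp (-4) / (real \<Delta> + 1)\<^sup>2"
  have \<epsilon>: "0 < \<epsilon>" "(real \<Delta> + 1)\<^sup>2 * (exp 1 * \<epsilon>) = exp (-3)"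
    by (simp_all add: \<epsilon>_def power2_eq_square add_pos_nonneg flip: exp_add)
  define R where "R = nat \<lceil>2 / \<epsilon>\<rceil>"
  define c where "c = 1 / (2 * ln (2 * (real \<Delta> + 1)))"
  define C where "C = max c (R * (2 + 1 / ln (1 + \<alpha>)))"
  define P where "P n = measure_pmf.prob (loads (G n) n)
      {x. c * ln (ln (real n)) \<le> real (max_load (G n) x) \<and>
          real (max_load (G n) x) \<le> C * ln (ln (real n))}" for n
  \<comment> \<open>The failure bound of \<open>prob_max_load_between\<close> with
    \<open>fact K\<close> replaced by its eventual upper bound \<open>sqrt n\<close>.\<close>
  define \<delta> where "\<delta> n = R / n + exp 1 * n * exp (- (sqrt n / exp 1))" for n :: nat
  have "(\<delta> \<longlongrightarrow> 0) sequentially"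
    unfolding \<delta>_def by real_asymp
  then have lim: "((\<lambda>n. 1 - \<delta> n) \<longlongrightarrow> 1) (inf sequentially (principal I))"
    by (intro tendsto_mono[OF inf_le1]) (auto intro!: tendsto_eq_intros)
  have "eventually (\<lambda>n. 1 \<le> \<epsilon> * real n) sequentially"
    using \<epsilon>(1) by real_asymp
  moreover have "eventually (\<lambda>n. 1 \<le> ln (ln (real n))) sequentially"
    by real_asymp
  ultimately have "eventually (\<lambda>n. n \<in> I \<longrightarrow> 1 - \<delta> n \<le> P n) sequentially"
    using fact_ceiling_sqrt_ln_le
  proof eventually_elim
    case (elim n)
    show ?case
    proof
      assume n: "n \<in> I"
      interpret graph "G n"
        using assms(2)[OF n] .
      have card: "card (verts (G n)) = n"
        using assms(4)[OF n] .
      let ?K = "nat \<lceil>sqrt (ln (real n))\<rceil>"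
      have "0 < n"
        using elim(1) by (cases "n = 0") auto
      have "sqrt n / exp 1 = n / (exp 1 * sqrt n)"
        by (metis divide_divide_eq_left mult.commute of_nat_0_le_iff real_div_sqrt)
      also have "\<dots> \<le> n / (exp 1 * fact ?K)"
        using elim(3) \<open>0 < n\<close>
        by (intro divide_left_mono mult_left_mono mult_pos_pos)
           (auto intro: less_le_trans[OF fact_gt_zero])
      finally have "1 - \<delta> n \<le> 1 - (R / n + exp 1 * n * exp (- (n / (exp 1 * fact ?K))))"
        by (simp add: \<delta>_def mult_left_mono)
      also have "\<dots> \<le> measure_pmf.prob (loads (G n) n)
          {x. c * ln (ln (real n)) \<le> real (max_load (G n) x) \<and>
              real (max_load (G n) x) \<le> R * (2 + 1 / ln (1 + \<alpha>)) * ln (ln (real n))}"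
        using prob_max_load_between[of \<Delta> \<alpha> \<epsilon>] assms(5)[OF n] \<alpha> \<epsilon> n elim(1,2)
        unfolding card R_def c_def by simp
      also have "\<dots> \<le> P n"
        unfolding P_def
      proof (rule measure_pmf.finite_measure_mono)
        have "R * (2 + 1 / ln (1 + \<alpha>)) * ln (ln (real n)) \<le> C * ln (ln (real n))"
          using elim(2) by (intro mult_right_mono) (auto simp: C_def)
        then show "{x. c * ln (ln (real n)) \<le> real (max_load (G n) x) \<and>
              real (max_load (G n) x) \<le> R * (2 + 1 / ln (1 + \<alpha>)) * ln (ln (real n))} \<subseteq>
            {x. c * ln (ln (real n)) \<le> real (max_load (G n) x) \<and>
              real (max_load (G n) x) \<le> C * ln (ln (real n))}"
          by auto
      qed simp
      finally show "1 - \<delta> n \<le> P n" .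
    qed
  qed
  then have "eventually (\<lambda>n. 1 - \<delta> n \<le> P n) (inf sequentially (principal I))"
    by (simp add: eventually_inf_principal)
  moreover have "eventually (\<lambda>n. P n \<le> 1) (inf sequentially (principal I))"
    by (simp add: P_def)
  ultimately have "(P \<longlongrightarrow> 1) (inf sequentially (principal I))"
    using lim tendsto_const by (rule tendsto_sandwich)
  moreover have "0 < c" "c \<le> C"
    by (simp_all add: c_def C_def)
  ultimately show ?thesis
    unfolding P_def by blast
qed

end
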